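(* Let $r\ge 0$ be an integer, let $\gamma_M\ge 0$ and $\gamma_A\ge 0$, and let $\widehat f$ be a numerical flux satisfying consistency, monotonicity and continuity (as defined in the context). Let $u_h(\cdot,t)\in\mathcal V_h^r$, $t\geq 0$, be a (continuously differentiable in $t$) solution of the semi-discrete stabilized cut DG scheme for the periodic scalar hyperbolic equation $u_t+(f(u))_x=0$ on $\Omega=(x_l,x_r)$, that is, $$(u_{h,t},v_h)_\Omega+\gamma_M J_1(u_{h,t},v_h)+a(u_h,v_h)+\gamma_A J_0(u_h,v_h)=0\qquad\forall v_h\in\mathcal V_h^r,\ t>0 .$$ Then for all $t\ge 0$ $$\|u_h(\cdot,t)\|_\Omega^2+\gamma_M J_1(u_h(\cdot,t),u_h(\cdot,t))\le \|u_h(\cdot,0)\|_\Omega^2+\gamma_M J_1(u_h(\cdot,0),u_h(\cdot,0)).$$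
   Context: **Mesh.** The background mesh is $x_L=x_{1/2}<x_{3/2}<\dots<x_{N+1/2}=x_R$, $N\ge2$, with elements $I_j=[x_{j-1/2},x_{j+1/2}]$ all of length $h$. The physical domain is $\Omega=(x_l,x_r)$ with $x_r=x_R=x_{N+1/2}$ and $x_l=x_{3/2}-\alpha h$, $\alpha\in(0,1]$, so that only $I_1$ is cut: $I_1\cap\Omega$ has length $\alpha h$ and $I_j\cap\Omega$ has length $h$ for $j\ge2$. The set of stabilized faces is $\mathcal F_\Gamma=\{x_{3/2}\}$. **Discrete space.** $\mathcal V_h^r=\{v: v|_{I_j}\in P^r(I_j),\ j=1,\dots,N\}$, where $P^r(I_j)$ is the space of polynomials of degree at most $r$ on $I_j$ (functions are discontinuous across element interfaces, and the polynomials are defined on the whole background elements). **Notation.** $v^\pm(x)$ are the right ($+$) and left ($-$) limits of $v$ at $x$; $[v]=v^+-v^-$; $(v,w)_K=\int_K vw\,dx$, $\|v\|_K=\sqrt{(v,v)_K}$. A subscript $j\pm\frac12$ denotes evaluation at $x_{j\pm1/2}$ and a subscript $l$ evaluation at $x_l$; $v_l=v^+(x_l)$. Periodic boundary conditions mean $u_h^-(x_l):=u_h^-(x_{N+1/2})$ and $u_h^+(x_{N+1/2}):=u_h^+(x_l)$. **Numerical flux.** $\widehat f_*=\widehat f(u_h^-(x_*,t),u_h^+(x_*,t))$. Consistency: $\widehat f(u,u)=f(u)$. Continuity: $\widehat f(u^-,u^+)$ is at least Lipschitz continuous in both arguments. Monotonicity: $\widehat f$ is non-decreasing in its first argument and non-increasing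 in its second argument. **Forms.** $$a(u,v)=\widehat f_{N+\frac12}v^-_{N+\frac12}-\widehat f_l v_l-\sum_{j=2}^N\widehat f_{j-\frac12}[v]_{j-\frac12}-\sum_{j=1}^N (f(u),v_x)_{I_j\cap\Omega},$$ where $\widehat f_*$ is computed from $u$, and for $s=0,1$ $$J_s(u,v)=\sum_{F\in\mathcal F_\Gamma}\sum_{k=0}^r w_k h^{2k+s}[\partial^k u]_F[\partial^k v]_F,$$ with fixed positive weights $w_k>0$ (for example $w_k=\frac1{(2k+1)(k!)^2}$). *)

theory Defs
  imports "HOL-Analysis.Analysis" "HOL-Computational_Algebra.Polynomial"
begin

text \<open>
  The half-integer mesh points are shifted to natural indices: \<open>xf j\<close> stands for \<open>x\<^sub>j\<^sub>+\<^sub>1\<^sub>/\<^sub>2\<close>,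
  so \<open>x\<^sub>j\<^sub>-\<^sub>1\<^sub>/\<^sub>2\<close> is \<open>xf (j - 1)\<close> for \<open>j \<ge> 1\<close>; the mesh runs from \<open>xf 0\<close> to \<open>xf N\<close>, and
  \<open>x\<^sub>3\<^sub>/\<^sub>2\<close> is \<open>xf 1\<close>.
\<close>

definition cut_mesh :: "nat \<Rightarrow> (nat \<Rightarrow> real) \<Rightarrow> real \<Rightarrow> real \<Rightarrow> bool" where
  "cut_mesh N xf h \<alpha> \<longleftrightarrow>
     2 \<le> N \<and> 0 < h \<and> (\<forall>j\<in>{1..N}. xf j - xf (j - 1) = h) \<and> 0 < \<alpha> \<and> \<alpha> \<le> 1"

definition elem :: "(nat \<Rightarrow> real) \<Rightarrow> nat \<Rightarrow> real set" where
  "elem xf j = {xf (j - 1)..xf j}"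

definition x_left :: "(nat \<Rightarrow> real) \<Rightarrow> real \<Rightarrow> real \<Rightarrow> real" where
  "x_left xf h \<alpha> = xf 1 - \<alpha> * h"

definition Omega :: "nat \<Rightarrow> (nat \<Rightarrow> real) \<Rightarrow> real \<Rightarrow> real \<Rightarrow> real set" where
  "Omega N xf h \<alpha> = {x_left xf h \<alpha> <..< xf N}"

definition stab_faces :: "(nat \<Rightarrow> real) \<Rightarrow> real set" where
  "stab_faces xf = {xf 1}"

text \<open>
  Broken polynomials on the background mesh. A polynomial is prescribed on the interior of each
  element only: requiring it on the closed elements would force continuity across the interfaces.
  The values at mesh points are thus irrelevant; only one-sided limits are used there.
\<close>

definition dg_space :: "nat \<Rightarrow> (nat \<Rightarrow> real) \<Rightarrow> nat \<Rightarrow> (real \<Rightarrow> real) set" where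
  "dg_space N xf r =
     {v. \<forall>j\<in>{1..N}. \<exists>p :: real poly. degree p \<le> r \<and> (\<forall>x\<in>interior (elem xf j). v x = poly p x)}"

definition rlim :: "(real \<Rightarrow> real) \<Rightarrow> real \<Rightarrow> real" where
  "rlim v x = Lim (at_right x) v"

definition llim :: "(real \<Rightarrow> real) \<Rightarrow> real \<Rightarrow> real" where
  "llim v x = Lim (at_left x) v"

definition jump :: "(real \<Rightarrow> real) \<Rightarrow> real \<Rightarrow> real" where
  "jump v x = rlim v x - llim v x"

definition L2_inner :: "real set \<Rightarrow> (real \<Rightarrow> real) \<Rightarrow> (real \<Rightarrow> real) \<Rightarrow> real" where
  "L2_inner K v w = (LINT x:K|lborel. v x * w x)"

definition L2_norm :: "real set \<Rightarrow> (real \<Rightarrow> real) \<Rightarrow> real" where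
  "L2_norm K v = sqrt (L2_inner K v v)"

definition flux_consistent :: "(real \<Rightarrow> real) \<Rightarrow> (real \<Rightarrow> real \<Rightarrow> real) \<Rightarrow> bool" where
  "flux_consistent f F \<longleftrightarrow> (\<forall>u. F u u = f u)"

definition flux_monotone :: "(real \<Rightarrow> real \<Rightarrow> real) \<Rightarrow> bool" where
  "flux_monotone F \<longleftrightarrow> (\<forall>b. mono (\<lambda>a. F a b)) \<and> (\<forall>a. antimono (\<lambda>b. F a b))"

text \<open>
  Lipschitz continuity is required on bounded sets only. This includes globally Lipschitz fluxes
  as well as the usual fluxes for nonlinear problems such as Burgers' equation.
\<close>

definition flux_lipschitz :: "(real \<Rightarrow> real \<Rightarrow> real) \<Rightarrow> bool" where
  "flux_lipschitz F \<longleftrightarrow>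
     (\<forall>M. \<exists>L. (\<forall>b\<in>{-M..M}. L-lipschitz_on {-M..M} (\<lambda>a. F a b)) \<and>
              (\<forall>a\<in>{-M..M}. L-lipschitz_on {-M..M} (\<lambda>b. F a b)))"

text \<open>
  The periodic boundary conditions replace the left limit at \<open>x\<^sub>l\<close> by the one at \<open>xf N\<close>, and the
  right limit at \<open>xf N\<close> by the one at \<open>x\<^sub>l\<close>.
\<close>

definition num_flux ::
  "nat \<Rightarrow> (nat \<Rightarrow> real) \<Rightarrow> real \<Rightarrow> real \<Rightarrow> (real \<Rightarrow> real \<Rightarrow> real) \<Rightarrow> (real \<Rightarrow> real) \<Rightarrow> real \<Rightarrow> real" where
  "num_flux N xf h \<alpha> F u x =
     F (if x = x_left xf h \<alpha> then llim u (xf N) else llim u x)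
       (if x = xf N then rlim u (x_left xf h \<alpha>) else rlim u x)"

definition form_a ::
  "nat \<Rightarrow> (nat \<Rightarrow> real) \<Rightarrow> real \<Rightarrow> real \<Rightarrow> (real \<Rightarrow> real) \<Rightarrow> (real \<Rightarrow> real \<Rightarrow> real) \<Rightarrow>
     (real \<Rightarrow> real) \<Rightarrow> (real \<Rightarrow> real) \<Rightarrow> real" where
  "form_a N xf h \<alpha> f F u v =
     num_flux N xf h \<alpha> F u (xf N) * llim v (xf N)
     - num_flux N xf h \<alpha> F u (x_left xf h \<alpha>) * rlim v (x_left xf h \<alpha>)
     - (\<Sum>j=2..N. num_flux N xf h \<alpha> F u (xf (j - 1)) * jump v (xf (j - 1)))
     - (\<Sum>j=1..N. L2_inner (elem xf j \<inter> Omega N xf h \<alpha>) (\<lambda>x. f (u x)) (deriv v))"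

definition form_J ::
  "nat \<Rightarrow> (nat \<Rightarrow> real) \<Rightarrow> real \<Rightarrow> nat \<Rightarrow> (nat \<Rightarrow> real) \<Rightarrow> (real \<Rightarrow> real) \<Rightarrow> (real \<Rightarrow> real) \<Rightarrow> real" where
  "form_J s xf h r w u v =
     (\<Sum>y\<in>stab_faces xf. \<Sum>k=0..r.
        w k * h ^ (2 * k + s) * jump ((deriv ^^ k) u) y * jump ((deriv ^^ k) v) y)"

text \<open>
  \<open>u\<close> is continuously differentiable in time on \<open>[0, \<infinity>)\<close> with time derivative \<open>ut\<close> (one-sided at
  \<open>0\<close>). The condition is pointwise in the element interiors, where the broken polynomials are
  determined; on the space of broken polynomials this is the same as continuous differentiability
  of the coefficients.
\<close>

definition C1_in_time ::
  "nat \<Rightarrow> (nat \<Rightarrow> real) \<Rightarrow> (real \<Rightarrow> real \<Rightarrow> real) \<Rightarrow> (real \<Rightarrow> real \<Rightarrow> real) \<Rightarrow> bool" where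
  "C1_in_time N xf u ut \<longleftrightarrow>
     (\<forall>j\<in>{1..N}. \<forall>x\<in>interior (elem xf j).
        (\<forall>t\<ge>0. ((\<lambda>s. u s x) has_real_derivative ut t x) (at t within {0..})) \<and>
        continuous_on {0..} (\<lambda>t. ut t x))"

end

theory Submission
  imports Defs
begin

text \<open>
  Testing the scheme with \<open>v\<^sub>h = u\<^sub>h\<close> shows that half the time derivative of the energy
  \<open>\<parallel>u\<^sub>h\<parallel>\<^sup>2 + \<gamma>\<^sub>M J\<^sub>1(u\<^sub>h, u\<^sub>h)\<close> is \<open>- a(u\<^sub>h, u\<^sub>h) - \<gamma>\<^sub>A J\<^sub>0(u\<^sub>h, u\<^sub>h)\<close>. With \<open>G' = f\<close>, the volume
  terms of \<open>a(u\<^sub>h, u\<^sub>h)\<close> integrate exactly, and periodicity turns \<open>a(u\<^sub>h, u\<^sub>h)\<close> into a sum over the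
  faces of \<open>G(u\<^sup>+) - G(u\<^sup>-) - F(u\<^sup>-, u\<^sup>+) (u\<^sup>+ - u\<^sup>-)\<close>. By the mean value theorem each of these is
  \<open>(f(z) - F(u\<^sup>-, u\<^sup>+)) (u\<^sup>+ - u\<^sup>-)\<close> with \<open>z\<close> between \<open>u\<^sup>-\<close> and \<open>u\<^sup>+\<close>, which is nonnegative since
  \<open>f(z) = F(z, z)\<close> and \<open>F\<close> is monotone.
\<close>

section \<open>Polynomial interpolation and time derivatives of linear and quadratic
  functionals\<close>

text \<open>Both sides have degree at most \<open>r\<close> and agree at \<open>r + 1\<close>
  points. The order of quantifiers is what matters: one family \<open>L\<close> serves every
  \<open>p\<close>, so a time-dependent polynomial has fixed basis elements and its values at the
  nodes as coefficients.\<close>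

lemma lagrange_basis:
  fixes A :: "'a :: field set"
  assumes "finite A" "card A = Suc r"
  shows "\<exists>L. \<forall>p. degree p \<le> r \<longrightarrow> p = (\<Sum>a\<in>A. smult (poly p a) (L a))"
proof -
  define L where "L a = (\<Prod>b\<in>A - {a}. smult (inverse (a - b)) [:- b, 1:])" for a
  have L_deg: "degree (L a) \<le> r" if "a \<in> A" for a
  proof -
    have "degree (L a) \<le> sum (degree \<circ> (\<lambda>b. smult (inverse (a - b)) [:- b, 1:])) (A - {a})"
      unfolding L_def by (rule degree_prod_sum_le) (use assms in auto)
    also have "\<dots> \<le> (\<Sum>b\<in>A - {a}. 1)"
      by (rule sum_mono) (auto simp: degree_smult_eq)
    also have "\<dots> = r" using assms that by (simp add: card_Diff_singleton)
    finally show ?thesis .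
  qed
  have L_poly: "poly (L a) b = (if a = b then 1 else 0)" if "a \<in> A" "b \<in> A" for a b
  proof (cases "a = b")
    case True
    have "poly (L a) a = (\<Prod>b\<in>A - {a}. 1)"
      unfolding L_def poly_prod by (intro prod.cong refl) (auto simp: field_simps)
    then show ?thesis using True by simp
  next
    case False
    then have "(\<Prod>c\<in>A - {a}. poly (smult (inverse (a - c)) [:- c, 1:]) b) = 0"
      using assms(1) that by (intro prod_zero) (auto intro!: bexI[of _ b])
    then show ?thesis using False by (simp add: L_def poly_prod)
  qed
  show ?thesis
  proof (intro exI allI impI)
    fix p :: "'a poly" assume p: "degree p \<le> r"
    show "p = (\<Sum>a\<in>A. smult (poly p a) (L a))"
    proof (rule poly_eqI_degree[of A])
      fix b assume b: "b \<in> A"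
      have "poly (\<Sum>a\<in>A. smult (poly p a) (L a)) b = (\<Sum>a\<in>A. if a = b then poly p a else 0)"
        unfolding poly_sum by (intro sum.cong refl) (use L_poly b in auto)
      then show "poly p b = poly (\<Sum>a\<in>A. smult (poly p a) (L a)) b"
        using b assms(1) by simp
    next
      have "degree (\<Sum>a\<in>A. smult (poly p a) (L a)) \<le> r"
        by (rule degree_sum_le) (use assms L_deg in \<open>auto intro: order.trans[OF degree_smult_le]\<close>)
      then show "degree (\<Sum>a\<in>A. smult (poly p a) (L a)) < card A" using assms(2) by simp
    qed (use p assms(2) in simp)
  qed
qed

lemma linear_functional_poly_sum:
  fixes \<Lambda> :: "real poly \<Rightarrow> real"
  assumes add: "\<And>p q. \<Lambda> (p + q) = \<Lambda> p + \<Lambda> q"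
    and smult: "\<And>c p. \<Lambda> (smult c p) = c * \<Lambda> p"
  shows "\<Lambda> (\<Sum>a\<in>A. smult (c a) (L a)) = (\<Sum>a\<in>A. c a * \<Lambda> (L a))"
proof -
  have "\<Lambda> 0 = 0" using smult[of 0 0] by simp
  then show ?thesis
    by (induction A rule: infinite_finite_induct) (simp_all add: add smult)
qed

text \<open>Time enters only through the scalar coefficients, so the functional becomes a finite sum
  of these coefficients times the constants \<open>\<Lambda> (L a)\<close>. It is applied to point
  evaluation, also of higher derivatives.\<close>

lemma has_derivative_linear_functional_poly:
  fixes \<Lambda> :: "real poly \<Rightarrow> real"
  assumes add: "\<And>p q. \<Lambda> (p + q) = \<Lambda> p + \<Lambda> q"
    and smult: "\<And>c p. \<Lambda> (smult c p) = c * \<Lambda> p"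
    and c: "\<And>a. a \<in> A \<Longrightarrow> (c a has_real_derivative c' a) (at t within S)"
  shows "((\<lambda>s. \<Lambda> (\<Sum>a\<in>A. smult (c a s) (L a))) has_real_derivative
           \<Lambda> (\<Sum>a\<in>A. smult (c' a) (L a))) (at t within S)"
  unfolding linear_functional_poly_sum[of \<Lambda>, OF add smult]
  by (auto intro!: derivative_eq_intros c)

text \<open>This is the product rule for a symmetric bilinear form; it yields the time derivative of
  the squared L2 norm on one element.\<close>

lemma has_derivative_quadratic_form_poly:
  fixes \<beta> :: "real poly \<Rightarrow> real poly \<Rightarrow> real" and L :: "'b \<Rightarrow> real poly"
  assumes add: "\<And>p q s. \<beta> (p + q) s = \<beta> p s + \<beta> q s"
    and smult: "\<And>c p s. \<beta> (smult c p) s = c * \<beta> p s"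
    and commute: "\<And>p q. \<beta> p q = \<beta> q p"
    and c: "\<And>a. a \<in> A \<Longrightarrow> (c a has_real_derivative c' a) (at t within S)"
  defines "P \<equiv> \<lambda>s. \<Sum>a\<in>A. smult (c a s) (L a)"
  shows "((\<lambda>s. \<beta> (P s) (P s)) has_real_derivative 2 * \<beta> (\<Sum>a\<in>A. smult (c' a) (L a)) (P t)) (at t within S)"
proof -
  have lin: "\<beta> (\<Sum>a\<in>A. smult (d a) (L a)) q = (\<Sum>a\<in>A. d a * \<beta> (L a) q)" for d q
    by (rule linear_functional_poly_sum) (simp_all add: add smult)
  \<comment> \<open>Symmetry turns linearity in the first argument into linearity in the
    second.\<close>
  have *: "((\<lambda>s. \<beta> (L b) (P s)) has_real_derivative \<beta> (L b) (\<Sum>a\<in>A. smult (c' a) (L a))) (at t within S)" for b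
    unfolding P_def
    by (rule has_derivative_linear_functional_poly)
       (use c in \<open>auto simp: add smult commute[of "L b"]\<close>)
  let ?D = "\<Sum>a\<in>A. smult (c' a) (L a)"
  have expand: "\<beta> (P s) q = (\<Sum>a\<in>A. c a s * \<beta> (L a) q)" for s q
    unfolding P_def lin ..
  have "((\<lambda>s. \<beta> (P s) (P s)) has_real_derivative
     (\<Sum>a\<in>A. c' a * \<beta> (L a) (P t) + c a t * \<beta> (L a) ?D)) (at t within S)"
    unfolding expand by (auto intro!: derivative_eq_intros c * sum.cong)
  moreover have "(\<Sum>a\<in>A. c' a * \<beta> (L a) (P t) + c a t * \<beta> (L a) ?D) = \<beta> ?D (P t) + \<beta> (P t) ?D"
    by (simp add: lin expand sum.distrib)
  ultimately show ?thesis by (simp add: commute[of "P t"])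
qed

section \<open>One-sided limits and derivatives of functions that are polynomial on an open
  interval\<close>

lemma rlim_poly:
  assumes "a < b" "\<And>x. x \<in> {a<..<b} \<Longrightarrow> v x = poly p x"
  shows "rlim v a = poly p a"
proof -
  have "(poly p \<longlongrightarrow> poly p a) (at_right a)"
    by (rule tendsto_intros)+
  moreover have "\<forall>\<^sub>F x in at_right a. poly p x = v x"
    using assms by (auto simp: eventually_at_right_field)
  ultimately have "(v \<longlongrightarrow> poly p a) (at_right a)"
    by (rule Lim_transform_eventually)
  then show ?thesis unfolding rlim_def by (intro tendsto_Lim) auto
qed

lemma llim_poly:
  assumes "a < b" "\<And>x. x \<in> {a<..<b} \<Longrightarrow> v x = poly p x"
  shows "llim v b = poly p b"
proof -
  have "(poly p \<longlongrightarrow> poly p b) (at_left b)"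
    by (rule tendsto_intros)+
  moreover have "\<forall>\<^sub>F x in at_left b. poly p x = v x"
    using assms by (auto simp: eventually_at_left_field)
  ultimately have "(v \<longlongrightarrow> poly p b) (at_left b)"
    by (rule Lim_transform_eventually)
  then show ?thesis unfolding llim_def by (intro tendsto_Lim) auto
qed

lemma deriv_poly_on_interval:
  fixes v :: "real \<Rightarrow> real"
  assumes "\<And>x. x \<in> {a<..<b} \<Longrightarrow> v x = poly p x" "x \<in> {a<..<b}"
  shows "deriv v x = poly (pderiv p) x"
proof (rule DERIV_imp_deriv)
  have "eventually (\<lambda>y. y \<in> {a<..<b}) (nhds x)"
    by (rule eventually_nhds_in_open[OF open_greaterThanLessThan assms(2)])
  then have "eventually (\<lambda>y. v y = poly p y) (nhds x)"
    by eventually_elim (use assms in auto)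
  then show "(v has_real_derivative poly (pderiv p) x) (at x)"
    by (subst DERIV_cong_ev[OF refl _ refl]) (auto intro: poly_DERIV)
qed

text \<open>Each further \<open>deriv\<close> looks at a neighbourhood of \<open>x\<close>, hence
  the induction over all points of the open interval at once.\<close>

lemma higher_deriv_poly_on_interval:
  fixes v :: "real \<Rightarrow> real"
  assumes "\<And>x. x \<in> {a<..<b} \<Longrightarrow> v x = poly p x" "x \<in> {a<..<b}"
  shows "(deriv ^^ k) v x = poly ((pderiv ^^ k) p) x"
  using assms(2)
proof (induction k arbitrary: x)
  case (Suc k)
  from deriv_poly_on_interval[OF Suc.IH Suc.prems] show ?case by simp
qed (use assms in auto)

section \<open>Geometry of the cut mesh and traces at its nodes\<close>

text \<open>These are the mesh points of the physical domain: the cut point takes the place of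
  \<open>xf 0\<close>, so that the cut element needs no separate treatment in sums over
  elements.\<close>

definition node :: "(nat \<Rightarrow> real) \<Rightarrow> real \<Rightarrow> real \<Rightarrow> nat \<Rightarrow> real" where
  "node xf h \<alpha> j = (if j = 0 then x_left xf h \<alpha> else xf j)"

text \<open>The polynomials that \<open>dg_space\<close> only asserts to exist are named here, so
  that forms in \<open>v\<close> can be rewritten as forms in \<open>P\<close>.\<close>

definition piecewise :: "nat \<Rightarrow> (nat \<Rightarrow> real) \<Rightarrow> (real \<Rightarrow> real) \<Rightarrow> (nat \<Rightarrow> real poly) \<Rightarrow> bool" where
  "piecewise N xf v P \<longleftrightarrow> (\<forall>j\<in>{1..N}. \<forall>x\<in>{xf (j - 1)<..<xf j}. v x = poly (P j) x)"

lemma interior_elem: "interior (elem xf j) = {xf (j - 1)<..<xf j}"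
  by (simp add: elem_def)

lemma
  assumes "cut_mesh N xf h \<alpha>"
  shows mesh_step: "\<And>j. j \<in> {1..N} \<Longrightarrow> xf (j - 1) < xf j"
    and node_step: "\<And>j. j \<in> {1..N} \<Longrightarrow> node xf h \<alpha> (j - 1) < node xf h \<alpha> j"
    and x_left_ge: "xf 0 \<le> x_left xf h \<alpha>"
    and xf_mono: "\<And>i j. i \<le> j \<Longrightarrow> j \<le> N \<Longrightarrow> xf i \<le> xf j"
    and x_left_less: "\<And>j. j \<in> {1..N} \<Longrightarrow> x_left xf h \<alpha> < xf j"
proof -
  note m = assms[unfolded cut_mesh_def]
  show step: "xf (j - 1) < xf j" if "j \<in> {1..N}" for j
    using m that by (metis diff_gt_0_iff_gt)
  have h1: "xf 1 - xf 0 = h" using m by force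
  have l1: "x_left xf h \<alpha> < xf 1" using m by (simp add: x_left_def)
  \<comment> \<open>The bound \<open>\<alpha> \<le> 1\<close> keeps the cut point inside the first
    background element.\<close>
  have "\<alpha> * h \<le> 1 * h" using m by (intro mult_right_mono) auto
  then show "xf 0 \<le> x_left xf h \<alpha>" using h1 by (simp add: x_left_def)
  show xm: "xf i \<le> xf j" if "i \<le> j" "j \<le> N" for i j
    using that
  proof (induction j)
    case (Suc j)
    then show ?case using step[of "Suc j"] by (cases "i = Suc j") fastforce+
  qed simp
  show "x_left xf h \<alpha> < xf j" if "j \<in> {1..N}" for j
    using l1 xm[of 1 j] that by auto
  show "node xf h \<alpha> (j - 1) < node xf h \<alpha> j" if "j \<in> {1..N}" for j
    using step[OF that] l1 that by (cases "j = 1") (auto simp: node_def)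
qed

lemma node_interval_subset:
  assumes "cut_mesh N xf h \<alpha>" "j \<in> {1..N}"
  shows "{node xf h \<alpha> (j - 1)<..<node xf h \<alpha> j} \<subseteq> {xf (j - 1)<..<xf j}"
  using x_left_ge[OF assms(1)] assms(2) by (auto simp: node_def split: if_splits)

lemma piecewise_node:
  assumes "cut_mesh N xf h \<alpha>" "piecewise N xf v P" "j \<in> {1..N}"
    "x \<in> {node xf h \<alpha> (j - 1)<..<node xf h \<alpha> j}"
  shows "v x = poly (P j) x"
  using assms node_interval_subset[OF assms(1,3)] unfolding piecewise_def by blast

lemma rlim_node:
  assumes "cut_mesh N xf h \<alpha>" "piecewise N xf v P" "j < N"
  shows "rlim v (node xf h \<alpha> j) = poly (P (Suc j)) (node xf h \<alpha> j)"
  using node_step[OF assms(1), of "Suc j"] piecewise_node[OF assms(1,2), of "Suc j"] assms(3)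
  by (intro rlim_poly[where b = "node xf h \<alpha> (Suc j)"]) auto

lemma llim_node:
  assumes "cut_mesh N xf h \<alpha>" "piecewise N xf v P" "j \<in> {1..N}"
  shows "llim v (xf j) = poly (P j) (xf j)"
  using mesh_step[OF assms(1,3)] assms(2,3)
  by (intro llim_poly[where a = "xf (j - 1)"]) (auto simp: piecewise_def)

text \<open>Derivatives of a broken polynomial are again broken polynomials on the same mesh, so the
  trace lemmas apply to them; whatever \<open>deriv\<close> returns at the face itself does not
  affect the one-sided limits.\<close>

lemma jump_higher_deriv:
  assumes m: "cut_mesh N xf h \<alpha>" and P: "piecewise N xf v P"
  shows "jump ((deriv ^^ k) v) (xf 1)
    = poly ((pderiv ^^ k) (P 2)) (xf 1) - poly ((pderiv ^^ k) (P 1)) (xf 1)"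
proof -
  have "2 \<le> N" using m by (simp add: cut_mesh_def)
  then have "piecewise N xf ((deriv ^^ k) v) (\<lambda>j. (pderiv ^^ k) (P j))"
    using P unfolding piecewise_def by (metis higher_deriv_poly_on_interval)
  from rlim_node[OF m this, of 1] llim_node[OF m this, of 1] \<open>2 \<le> N\<close>
  show ?thesis by (simp add: jump_def node_def numeral_2_eq_2)
qed

section \<open>Integrals over elements and over the domain\<close>

text \<open>Countable sets are null. This disposes of the mesh points, where the values of a broken
  polynomial are arbitrary.\<close>

lemma integral_lborel_cong_except:
  fixes \<phi> \<psi> :: "real \<Rightarrow> real"
  assumes "countable X" "\<And>x. x \<notin> X \<Longrightarrow> \<phi> x = \<psi> x"
  shows "integral\<^sup>L lborel \<phi> = integral\<^sup>L lborel \<psi>"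
  by (rule integral_discrete_difference[of X]) (use assms in auto)

text \<open>A general integrand \<open>\<psi>\<close> is allowed because the lemma serves both
  products of polynomials and the volume term, which contains the nonlinear
  \<open>f\<close>.\<close>

lemma L2_inner_elem:
  assumes m: "cut_mesh N xf h \<alpha>" and j: "j \<in> {1..N}"
    and eq: "\<And>x. x \<in> {xf (j - 1)<..<xf j} \<Longrightarrow> v x * w x = \<psi> x"
  shows "L2_inner (elem xf j \<inter> Omega N xf h \<alpha>) v w
       = (LINT x:{node xf h \<alpha> (j - 1)..node xf h \<alpha> j}|lborel. \<psi> x)"
  unfolding L2_inner_def set_lebesgue_integral_def
proof (rule integral_lborel_cong_except[of "{xf (j - 1), xf j, x_left xf h \<alpha>, xf N}"])
  fix x assume x: "x \<notin> {xf (j - 1), xf j, x_left xf h \<alpha>, xf N}"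
  have "xf j \<le> xf N" "xf 0 \<le> x_left xf h \<alpha>" "x_left xf h \<alpha> < xf j"
    using xf_mono[OF m] x_left_ge[OF m] x_left_less[OF m] j by auto
  \<comment> \<open>Beyond the first element the cut point lies to the left, so intersecting with
    the domain removes at most an endpoint.\<close>
  moreover have "x_left xf h \<alpha> < xf (j - 1)" if "j > 1"
    by (rule x_left_less[OF m]) (use that j in auto)
  ultimately show "indicator (elem xf j \<inter> Omega N xf h \<alpha>) x *\<^sub>R (v x * w x)
      = indicator {node xf h \<alpha> (j - 1)..node xf h \<alpha> j} x *\<^sub>R \<psi> x"
    using eq[of x] x j by (cases "j = 1") (auto simp: indicator_def elem_def Omega_def node_def)
qed auto

definition poly_L2 :: "real \<Rightarrow> real \<Rightarrow> real poly \<Rightarrow> real poly \<Rightarrow> real" where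
  "poly_L2 a b p q = (LINT x:{a..b}|lborel. poly p x * poly q x)"

lemma poly_L2_bilinear:
  "poly_L2 a b (p + q) s = poly_L2 a b p s + poly_L2 a b q s"
  "poly_L2 a b (smult c p) s = c * poly_L2 a b p s"
  "poly_L2 a b p q = poly_L2 a b q p"
proof -
  have i: "set_integrable lborel {a..b} (\<lambda>x. poly p x * poly q x)" for p q
    by (intro borel_integrable_atLeastAtMost' continuous_intros)
  show "poly_L2 a b (p + q) s = poly_L2 a b p s + poly_L2 a b q s"
    unfolding poly_L2_def by (simp add: distrib_right set_integral_add(2)[OF i i])
  show "poly_L2 a b (smult c p) s = c * poly_L2 a b p s"
    unfolding poly_L2_def by (simp add: mult.assoc)
qed (simp add: poly_L2_def mult.commute)

lemma L2_inner_elem_poly: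
  assumes "cut_mesh N xf h \<alpha>" "j \<in> {1..N}" "piecewise N xf v P" "piecewise N xf w Q"
  shows "L2_inner (elem xf j \<inter> Omega N xf h \<alpha>) v w
       = poly_L2 (node xf h \<alpha> (j - 1)) (node xf h \<alpha> j) (P j) (Q j)"
  unfolding poly_L2_def
  by (rule L2_inner_elem) (use assms in \<open>auto simp: piecewise_def\<close>)

text \<open>Away from the nodes, every point of the domain lies in exactly one interval between
  consecutive nodes, so the indicator of the domain splits into a sum.\<close>

lemma L2_inner_Omega_poly:
  assumes m: "cut_mesh N xf h \<alpha>" and P: "piecewise N xf v P" and Q: "piecewise N xf w Q"
  shows "L2_inner (Omega N xf h \<alpha>) v w
       = (\<Sum>j=1..N. poly_L2 (node xf h \<alpha> (j - 1)) (node xf h \<alpha> j) (P j) (Q j))"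
proof -
  define \<phi> where "\<phi> j x = indicator {node xf h \<alpha> (j - 1)..node xf h \<alpha> j} x *\<^sub>R (poly (P j) x * poly (Q j) x)" for j x
  have "L2_inner (Omega N xf h \<alpha>) v w = (\<integral>x. (\<Sum>j=1..N. \<phi> j x) \<partial>lborel)"
    unfolding L2_inner_def set_lebesgue_integral_def
  proof (rule integral_lborel_cong_except[of "node xf h \<alpha> ` {0..N}"])
    fix x assume x: "x \<notin> node xf h \<alpha> ` {0..N}"
    have mono: "node xf h \<alpha> i \<le> node xf h \<alpha> j" if "i \<le> j" "j \<le> N" for i j
      using that
    proof (induction j)
      case (Suc j)
      then show ?case using node_step[OF m, of "Suc j"] by (cases "i = Suc j") fastforce+
    qed simp
    have N: "N \<ge> 1" using m by (simp add: cut_mesh_def)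
    have Om: "Omega N xf h \<alpha> = {node xf h \<alpha> 0<..<node xf h \<alpha> N}"
      using N by (auto simp: Omega_def node_def)
    show "indicator (Omega N xf h \<alpha>) x *\<^sub>R (v x * w x) = (\<Sum>j=1..N. \<phi> j x)"
    proof (cases "x \<in> Omega N xf h \<alpha>")
      case True
      \<comment> \<open>The least node index to the right of \<open>x\<close> identifies the element
        containing \<open>x\<close>.\<close>
      define i where "i = (LEAST i. x \<le> node xf h \<alpha> i)"
      have "x \<le> node xf h \<alpha> N" using True Om by auto
      then have i: "x \<le> node xf h \<alpha> i" "i \<le> N" unfolding i_def by (rule LeastI, rule Least_le)
      have "i \<noteq> 0" using i(1) True Om by (metis greaterThanLessThan_iff not_less)
      then have i1: "node xf h \<alpha> (i - 1) < x"
        using not_less_Least[of "i - 1" "\<lambda>i. x \<le> node xf h \<alpha> i"] by (auto simp: i_def[symmetric])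
      have i2: "x < node xf h \<alpha> i" using i x by (metis atLeastAtMost_iff imageI le0 order_le_less)
      have ii: "i \<in> {1..N}" using i \<open>i \<noteq> 0\<close> by auto
      have z: "\<phi> j x = 0" if "j \<in> {1..N} - {i}" for j
      proof -
        have "node xf h \<alpha> j < x \<or> x < node xf h \<alpha> (j - 1)"
        proof (cases "j < i")
          case True
          then have "node xf h \<alpha> j \<le> node xf h \<alpha> (i - 1)" using i by (intro mono) auto
          then show ?thesis using i1 by simp
        next
          case False
          then have "node xf h \<alpha> i \<le> node xf h \<alpha> (j - 1)" using that by (intro mono) auto
          then show ?thesis using i2 by simp
        qed
        then show ?thesis by (auto simp: \<phi>_def)
      qed
      have "(\<Sum>j=1..N. \<phi> j x) = \<phi> i x"
        using ii z by (subst sum.remove[of _ i]) auto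
      also have "\<dots> = v x * w x"
        using i1 i2 piecewise_node[OF m P ii, of x] piecewise_node[OF m Q ii, of x] by (simp add: \<phi>_def)
      finally show ?thesis using True by simp
    next
      case False
      then have "x < node xf h \<alpha> 0 \<or> node xf h \<alpha> N < x"
        using x Om by (metis atLeastAtMost_iff greaterThanLessThan_iff image_eqI le0 linorder_neqE_linordered_idom order_refl)
      then have "\<phi> j x = 0" if "j \<in> {1..N}" for j
        using that mono[of 0 "j - 1", OF le0 le_trans[OF diff_le_self]] mono[of j N] by (auto simp: \<phi>_def indicator_def)
      then show ?thesis using False by simp
    qed
  qed auto
  also have "\<dots> = (\<Sum>j=1..N. integral\<^sup>L lborel (\<phi> j))"
  proof (rule Bochner_Integration.integral_sum)
    have "set_integrable lborel {a..b} (\<lambda>x. poly p x * poly q x)" for a b and p q :: "real poly"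
      by (intro borel_integrable_atLeastAtMost' continuous_intros)
    then show "integrable lborel (\<phi> j)" for j
      by (simp add: \<phi>_def[abs_def] set_integrable_def)
  qed
  also have "\<dots> = (\<Sum>j=1..N. poly_L2 (node xf h \<alpha> (j - 1)) (node xf h \<alpha> j) (P j) (Q j))"
    by (simp add: poly_L2_def set_lebesgue_integral_def \<phi>_def[abs_def])
  finally show ?thesis .
qed

section \<open>Numerical flux: continuity of \<open>f\<close> and sign of the convection
  form\<close>

text \<open>By consistency \<open>f\<close> is the diagonal of \<open>F\<close>. Changing one
  argument at a time costs \<open>L\<close> twice, which gives the constant \<open>2 * L\<close>.
  Continuity is what provides an antiderivative of \<open>f\<close>.\<close>

lemma flux_lipschitz_imp_isCont:
  assumes "flux_consistent f F" "flux_lipschitz F"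
  shows "isCont f x"
proof -
  \<comment> \<open>The added 1 makes \<open>x\<close> an interior point of the interval.\<close>
  define M where "M = \<bar>x\<bar> + 1"
  obtain L where 1: "\<And>b. b \<in> {-M..M} \<Longrightarrow> L-lipschitz_on {-M..M} (\<lambda>a. F a b)"
    and 2: "\<And>a. a \<in> {-M..M} \<Longrightarrow> L-lipschitz_on {-M..M} (\<lambda>b. F a b)"
    using assms(2) unfolding flux_lipschitz_def by meson
  have "(2 * L)-lipschitz_on {-M..M} f"
  proof (rule lipschitz_onI)
    fix a b assume ab: "a \<in> {-M..M}" "b \<in> {-M..M}"
    have "dist (f a) (f b) \<le> dist (F a a) (F b a) + dist (F b a) (F b b)"
      using assms(1) dist_triangle by (simp add: flux_consistent_def)
    also have "\<dots> \<le> L * dist a b + L * dist a b"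
      using ab by (intro add_mono lipschitz_onD[OF 1] lipschitz_onD[OF 2])
    finally show "dist (f a) (f b) \<le> 2 * L * dist a b" by simp
  next
    have "0 \<in> {-M..M}" by (simp add: M_def)
    then show "0 \<le> 2 * L" using 1 lipschitz_on_nonneg by fastforce
  qed
  then have "continuous_on {-M..M} f" by (rule lipschitz_on_continuous_on)
  then have "continuous_on {-M<..<M} f" by (rule continuous_on_subset) auto
  moreover have "x \<in> {-M<..<M}" by (auto simp: M_def)
  ultimately show ?thesis
    using continuous_on_eq_continuous_at[OF open_greaterThanLessThan] by blast
qed

lemma monotone_flux_dissipation:
  assumes cons: "flux_consistent f F" and mono: "flux_monotone F"
    and G: "\<And>x. (G has_real_derivative f x) (at x)"
  shows "F a b * (b - a) \<le> G b - G a"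
proof -
  have up: "F s b \<le> F s' b" and dn: "F a s' \<le> F a s" if "s \<le> s'" for s s' a b
    using mono that unfolding flux_monotone_def mono_def antimono_def by blast+
  have fF: "f s = F s s" for s using cons by (simp add: flux_consistent_def)
  consider "a < b" | "b < a" | "a = b" by linarith
  then show ?thesis
  proof cases
    case 1
    then obtain z where z: "a < z" "z < b" "G b - G a = (b - a) * f z"
      using MVT2[of a b G f] G by blast
    \<comment> \<open>The chain is \<open>F a b \<le> F a z \<le> F z z\<close>: lower the second
      argument to \<open>z\<close>, then raise the first.\<close>
    have "F a b \<le> f z" using up[of a z z] dn[of z b a] z fF by auto
    then show ?thesis using z 1 by (simp add: mult.commute)
  next
    case 2
    then obtain z where z: "b < z" "z < a" "G a - G b = (a - b) * f z"
      using MVT2[of b a G f] G by blast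
    \<comment> \<open>With the order of \<open>a\<close> and \<open>b\<close> reversed, the chain is
      \<open>F z z \<le> F a z \<le> F a b\<close>.\<close>
    have "f z \<le> F a b" using up[of z a z] dn[of b z a] z fF by (metis less_imp_le order_trans)
    then have "(a - b) * f z \<le> (a - b) * F a b" using 2 by (intro mult_left_mono) auto
    then show ?thesis using z by (simp add: algebra_simps)
  qed simp
qed

lemma form_a_nonneg:
  assumes m: "cut_mesh N xf h \<alpha>" and flux: "flux_consistent f F" "flux_monotone F" "flux_lipschitz F"
    and P: "piecewise N xf v P"
  shows "0 \<le> form_a N xf h \<alpha> f F v v"
proof -
  have cont: "isCont f x" for x using flux_lipschitz_imp_isCont flux by blast
  have "\<exists>G. \<forall>x::real. -\<infinity> < ereal x \<longrightarrow> ereal x < \<infinity> \<longrightarrow> (G has_vector_derivative f x) (at x)"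
    by (rule einterval_antiderivative) (use cont in auto)
  then obtain G where G: "\<And>x. (G has_real_derivative f x) (at x)"
    by (auto simp: has_real_derivative_iff_has_vector_derivative)
  have N: "N \<ge> 2" using m by (simp add: cut_mesh_def)
  let ?n = "node xf h \<alpha>"
  \<comment> \<open>\<open>R j\<close> and \<open>M j\<close> are the right and left traces at node
    \<open>j\<close>. At the cut point, periodicity supplies \<open>M N\<close> as the left
    trace.\<close>
  define R where "R j = poly (P (Suc j)) (?n j)" for j
  define M where "M j = poly (P j) (?n j)" for j
  have node_xf: "?n j = xf j" if "j \<ge> 1" for j using that by (simp add: node_def)
  have rl: "rlim v (?n j) = R j" if "j < N" for j
    using rlim_node[OF m P that] by (simp add: R_def)
  have ll: "llim v (xf j) = M j" if "j \<in> {1..N}" for j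
    using llim_node[OF m P that] that by (simp add: M_def node_xf)
  have n0: "?n 0 = x_left xf h \<alpha>" by (simp add: node_def)
  have vol: "L2_inner (elem xf j \<inter> Omega N xf h \<alpha>) (\<lambda>x. f (v x)) (deriv v) = G (M j) - G (R (j - 1))"
    if j: "j \<in> {1..N}" for j
  proof -
    have vP: "v x = poly (P j) x" if "x \<in> {xf (j - 1)<..<xf j}" for x
      using P j that by (auto simp: piecewise_def)
    have "L2_inner (elem xf j \<inter> Omega N xf h \<alpha>) (\<lambda>x. f (v x)) (deriv v)
       = (LINT x:{?n (j - 1)..?n j}|lborel. f (poly (P j) x) * poly (pderiv (P j)) x)"
      by (rule L2_inner_elem[OF m j]) (simp only: vP deriv_poly_on_interval[OF vP])
    also have "\<dots> = G (poly (P j) (?n j)) - G (poly (P j) (?n (j - 1)))"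
      unfolding set_lebesgue_integral_def real_scaleR_def mult.commute[of "indicator _ _"]
    proof (rule integral_FTC_Icc_real)
      show "?n (j - 1) \<le> ?n j" using node_step[OF m j] by simp
      show "((\<lambda>x. G (poly (P j) x)) has_real_derivative f (poly (P j) x) * poly (pderiv (P j)) x) (at x)" for x
        by (rule DERIV_chain2[OF G poly_DERIV])
      show "isCont (\<lambda>x. f (poly (P j) x) * poly (pderiv (P j)) x) x" for x
        by (intro continuous_intros isCont_o2[OF _ cont]) 
    qed
    also have "\<dots> = G (M j) - G (R (j - 1))" using j by (simp add: M_def R_def)
    finally show ?thesis .
  qed
  \<comment> \<open>\<open>num_flux\<close> recognizes the two boundary points by equality; this
    fact and the next rule out the periodic replacement at interior faces.\<close>
  have xl: "xf j \<noteq> x_left xf h \<alpha>" if "j \<in> {1..N}" for j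
    using x_left_less[OF m that] by simp
  have xN: "xf (j - 1) \<noteq> xf N" if "j \<in> {2..N}" for j
  proof -
    have "xf (j - 1) < xf j" "xf j \<le> xf N" using mesh_step[OF m, of j] xf_mono[OF m, of j N] that by auto
    then show ?thesis by simp
  qed
  have pred: "j - 1 \<in> {1..N}" "j - 1 < N" if "j \<in> {2..N}" for j using that by auto
  have R0: "rlim v (x_left xf h \<alpha>) = R 0" using rl[of 0] n0 N by simp
  have MN: "llim v (xf N) = M N" using ll[of N] N by simp
  \<comment> \<open>Both boundary fluxes have the same value, so the two ends of the domain act as
    one more face with traces \<open>M N\<close> and \<open>R 0\<close>.\<close>
  have fN: "num_flux N xf h \<alpha> F v (xf N) = F (M N) (R 0)"
    using xl[of N] N R0 MN by (simp add: num_flux_def)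
  have f0: "num_flux N xf h \<alpha> F v (x_left xf h \<alpha>) = F (M N) (R 0)"
    using xl[of N] N R0 MN by (simp add: num_flux_def)
  have rj: "rlim v (xf (j - 1)) = R (j - 1)" and lj: "llim v (xf (j - 1)) = M (j - 1)"
    if "j \<in> {2..N}" for j
    using pred[OF that] rl[of "j - 1"] ll[of "j - 1"] node_xf[of "j - 1"] by auto
  have fj: "num_flux N xf h \<alpha> F v (xf (j - 1)) * jump v (xf (j - 1))
     = F (M (j - 1)) (R (j - 1)) * (R (j - 1) - M (j - 1))" if "j \<in> {2..N}" for j
    using xl[OF pred(1)[OF that]] xN[OF that] rj[OF that] lj[OF that] by (simp add: num_flux_def jump_def)
  \<comment> \<open>Regrouping from elements to faces: after shifting the index of the left traces,
    \<open>M N\<close> and \<open>R 0\<close> remain for the periodic face.\<close>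
  have split1: "(\<Sum>j=1..N. G (M j) - G (R (j - 1)))
     = G (M N) - G (R 0) - (\<Sum>j=2..N. G (R (j - 1)) - G (M (j - 1)))"
  proof -
    have "(\<Sum>j=1..N. G (M j)) = (\<Sum>j=2..N. G (M (j - 1))) + G (M N)"
      using N by (induction N rule: dec_induct) (auto simp: numeral_2_eq_2)
    moreover have "(\<Sum>j=1..N. G (R (j - 1))) = G (R 0) + (\<Sum>j=2..N. G (R (j - 1)))"
      using N by (subst sum.atLeast_Suc_atMost) (auto simp: numeral_2_eq_2)
    ultimately show ?thesis by (simp add: sum_subtractf)
  qed
  have fluxes: "(\<Sum>j=2..N. num_flux N xf h \<alpha> F v (xf (j - 1)) * jump v (xf (j - 1)))
      = (\<Sum>j=2..N. F (M (j - 1)) (R (j - 1)) * (R (j - 1) - M (j - 1)))"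
    by (intro sum.cong refl fj)
  have vols: "(\<Sum>j=1..N. L2_inner (elem xf j \<inter> Omega N xf h \<alpha>) (\<lambda>x. f (v x)) (deriv v))
      = (\<Sum>j=1..N. G (M j) - G (R (j - 1)))"
    by (intro sum.cong refl vol)
  have "form_a N xf h \<alpha> f F v v
      = (G (R 0) - G (M N) - F (M N) (R 0) * (R 0 - M N))
      + (\<Sum>j=2..N. G (R (j - 1)) - G (M (j - 1)) - F (M (j - 1)) (R (j - 1)) * (R (j - 1) - M (j - 1)))"
    unfolding form_a_def fN f0 R0 MN fluxes vols split1
    by (simp add: sum_subtractf right_diff_distrib)
  also have "\<dots> \<ge> 0"
    using monotone_flux_dissipation[OF flux(1,2) G]
    by (intro add_nonneg_nonneg sum_nonneg) (simp_all add: diff_ge_0_iff_ge)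
  finally show ?thesis .
qed

section \<open>Stabilization form and the energy estimate\<close>

text \<open>Each \<open>\<delta> k\<close> is linear in the two polynomials next to the face, which
  makes the form differentiable in time along with the coefficients.\<close>

lemma form_J_poly:
  assumes "cut_mesh N xf h \<alpha>" "piecewise N xf v P" "piecewise N xf v' Q"
  defines "\<delta> \<equiv> \<lambda>k P. poly ((pderiv ^^ k) (P 2)) (xf 1) - poly ((pderiv ^^ k) (P (1::nat))) (xf 1)"
  shows "form_J s xf h r w v v' = (\<Sum>k=0..r. w k * h ^ (2 * k + s) * \<delta> k P * \<delta> k Q)"
  by (simp add: form_J_def stab_faces_def \<delta>_def jump_higher_deriv[OF assms(1,2)]
      jump_higher_deriv[OF assms(1,3)] del: One_nat_def)

lemma form_J_nonneg:
  assumes "0 < h" "\<And>k. k \<le> r \<Longrightarrow> 0 < w k"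
  shows "0 \<le> form_J s xf h r w v v"
proof -
  have "0 \<le> w k * h ^ (2 * k + s) * (c * c)" if "k \<le> r" for k c
    using assms that by (intro mult_nonneg_nonneg[OF _ zero_le_square]) (simp add: less_imp_le)
  then show ?thesis
    unfolding form_J_def by (intro sum_nonneg) (simp add: mult.assoc)
qed

theorem theorem4p1:
  fixes N r :: nat
    and xf w :: "nat \<Rightarrow> real"
    and h \<alpha> \<gamma>M \<gamma>A :: real
    and f :: "real \<Rightarrow> real"
    and F u ut :: "real \<Rightarrow> real \<Rightarrow> real"
  assumes mesh: "cut_mesh N xf h \<alpha>"
    and weights: "\<And>k. k \<le> r \<Longrightarrow> 0 < w k"
    and gammas: "0 \<le> \<gamma>M" "0 \<le> \<gamma>A"
    and flux: "flux_consistent f F" "flux_monotone F" "flux_lipschitz F"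
    and space: "\<And>t. 0 \<le> t \<Longrightarrow> u t \<in> dg_space N xf r"
    and smooth: "C1_in_time N xf u ut"
    and scheme: "\<And>t v. 0 < t \<Longrightarrow> v \<in> dg_space N xf r \<Longrightarrow>
        L2_inner (Omega N xf h \<alpha>) (ut t) v + \<gamma>M * form_J 1 xf h r w (ut t) v
        + form_a N xf h \<alpha> f F (u t) v + \<gamma>A * form_J 0 xf h r w (u t) v = 0"
  shows "\<forall>t\<ge>0.
      (L2_norm (Omega N xf h \<alpha>) (u t))\<^sup>2 + \<gamma>M * form_J 1 xf h r w (u t) (u t)
      \<le> (L2_norm (Omega N xf h \<alpha>) (u 0))\<^sup>2 + \<gamma>M * form_J 1 xf h r w (u 0) (u 0)"
proof -
  let ?n = "node xf h \<alpha>" and ?\<Omega> = "Omega N xf h \<alpha>"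
  \<comment> \<open>Interpolation nodes are taken in the open element, where
    \<open>C1_in_time\<close> gives the time derivative of \<open>u\<close> pointwise.\<close>
  have "\<exists>A L. A \<subseteq> {xf (j - 1)<..<xf j} \<and> finite A \<and>
      (\<forall>p::real poly. degree p \<le> r \<longrightarrow> p = (\<Sum>a\<in>A. smult (poly p a) (L a)))" if "j \<in> {1..N}" for j
  proof -
    have "infinite {xf (j - 1)<..<xf j}" using mesh_step[OF mesh that] by simp
    then obtain A where A: "finite A" "card A = Suc r" "A \<subseteq> {xf (j - 1)<..<xf j}"
      using infinite_arbitrarily_large by blast
    from lagrange_basis[OF A(1,2)] A show ?thesis by blast
  qed
  then obtain A L where A: "\<And>j. j \<in> {1..N} \<Longrightarrow> A j \<subseteq> {xf (j - 1)<..<xf j}"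
    and L: "\<And>j p. j \<in> {1..N} \<Longrightarrow> degree p \<le> r \<Longrightarrow> p = (\<Sum>a\<in>A j. smult (poly p a) (L j a))"
    by metis
  define P where "P t j = (\<Sum>a\<in>A j. smult (u t a) (L j a))" for t j
  define P' where "P' t j = (\<Sum>a\<in>A j. smult (ut t a) (L j a))" for t j
  have u_deriv: "((\<lambda>s. u s x) has_real_derivative ut t x) (at t within {0..})"
    if "0 \<le> t" "j \<in> {1..N}" "x \<in> {xf (j - 1)<..<xf j}" for t j x
    using smooth that unfolding C1_in_time_def interior_elem by blast
  have P: "piecewise N xf (u t) (P t)" if t: "0 \<le> t" for t
    unfolding piecewise_def
  proof (intro ballI)
    fix j x assume j: "j \<in> {1..N}" and x: "x \<in> {xf (j - 1)<..<xf j}"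
    obtain p where p: "degree p \<le> r" "\<And>x. x \<in> {xf (j - 1)<..<xf j} \<Longrightarrow> u t x = poly p x"
      using space[OF t] j unfolding dg_space_def interior_elem by blast
    have "P t j = (\<Sum>a\<in>A j. smult (poly p a) (L j a))"
      unfolding P_def using A[OF j] p(2) by (intro sum.cong) auto
    with L[OF j p(1)] p(2) x show "u t x = poly (P t j) x" by simp
  qed
  text \<open>Interpolation at fixed nodes shows that the time derivative is again a broken polynomial.\<close>
  have P': "piecewise N xf (ut t) (P' t)" if t: "0 < t" for t
    unfolding piecewise_def
  proof (intro ballI)
    fix j x assume j: "j \<in> {1..N}" and x: "x \<in> {xf (j - 1)<..<xf j}"
    have "((\<lambda>s. poly (P s j) x) has_real_derivative poly (P' t j) x) (at t within {0..})"
      unfolding P_def P'_def using that j A[OF j]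
      by (intro has_derivative_linear_functional_poly u_deriv) auto
    then have "((\<lambda>s. u s x) has_real_derivative poly (P' t j) x) (at t within {0..})"
      by (rule has_field_derivative_transform_within[where d = 1])
         (use that P j x in \<open>auto simp: piecewise_def\<close>)
    \<comment> \<open>For \<open>t > 0\<close> the filter \<open>at t within {0..}\<close> is the
      full \<open>at t\<close>, where derivatives are unique.\<close>
    with u_deriv[OF _ j x, of t] that show "ut t x = poly (P' t j) x"
      by (auto simp: at_within_interior[of t "{0..}"] interior_real_atLeast intro: DERIV_unique)
  qed
  define \<delta> where "\<delta> k Q = poly ((pderiv ^^ k) (Q 2)) (xf 1) - poly ((pderiv ^^ k) (Q (1::nat))) (xf 1)" for k Q
  \<comment> \<open>This is the bilinear form of the time-derivative terms, moved to polynomials;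
    \<open>B (P t) (P t)\<close> is the energy.\<close>
  define B where "B P Q = (\<Sum>j=1..N. poly_L2 (?n (j - 1)) (?n j) (P j) (Q j))
      + \<gamma>M * (\<Sum>k=0..r. w k * h ^ (2 * k + 1) * \<delta> k P * \<delta> k Q)" for P Q
  have B: "L2_inner ?\<Omega> v v' + \<gamma>M * form_J 1 xf h r w v v' = B Q Q'"
    if "piecewise N xf v Q" "piecewise N xf v' Q'" for v v' Q Q'
    using L2_inner_Omega_poly[OF mesh that] form_J_poly[OF mesh that] by (simp add: B_def \<delta>_def)
  have B_deriv: "((\<lambda>s. B (P s) (P s)) has_real_derivative 2 * B (P' t) (P t)) (at t within {0..})"
    if t: "0 \<le> t" for t
  proof -
    have d1: "((\<lambda>s. poly_L2 a b (P s j) (P s j)) has_real_derivative 2 * poly_L2 a b (P' t j) (P t j))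
        (at t within {0..})" if j: "j \<in> {1..N}" for a b j
      unfolding P_def P'_def using A[OF j]
      by (intro has_derivative_quadratic_form_poly u_deriv[OF t j]) (auto simp: poly_L2_bilinear(1,2) intro: poly_L2_bilinear(3))
    have d2: "((\<lambda>s. poly ((pderiv ^^ k) (P s j)) y) has_real_derivative poly ((pderiv ^^ k) (P' t j)) y)
        (at t within {0..})" if j: "j \<in> {1..N}" for k j y
      unfolding P_def P'_def using A[OF j]
      by (intro has_derivative_linear_functional_poly u_deriv[OF t j])
         (auto simp: higher_pderiv_add higher_pderiv_smult)
    have N: "2 \<in> {1..N}" "1 \<in> {1..N}" using mesh by (auto simp: cut_mesh_def)
    have d3: "((\<lambda>s. \<delta> k (P s)) has_real_derivative \<delta> k (P' t)) (at t within {0..})" for k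
      unfolding \<delta>_def by (intro DERIV_diff d2 N)
    show ?thesis
      unfolding B_def
      by (auto intro!: derivative_eq_intros d1 d3 simp: sum_distrib_left algebra_simps sum.distrib)
  qed
  have norm: "(L2_norm ?\<Omega> v)\<^sup>2 = L2_inner ?\<Omega> v v" for v
    unfolding L2_norm_def
    by (rule real_sqrt_pow2) (auto simp: L2_inner_def set_lebesgue_integral_def intro!: integral_nonneg)
  show ?thesis
  proof (intro allI impI)
    fix t :: real assume t: "0 \<le> t"
    have "B (P t) (P t) \<le> B (P 0) (P 0)"
    \<comment> \<open>The scheme holds only for positive times, so the sign of the derivative is
      known on the open interval; continuity of the energy extends the estimate to the initial
      time.\<close>
    proof (rule DERIV_nonpos_imp_decreasing_open[OF t])
      fix s assume s: "0 < s" "s < t"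
      have "0 < h" using mesh by (simp add: cut_mesh_def)
      \<comment> \<open>The test function is \<open>u s\<close> itself; the derivative of the energy
        is twice the first term.\<close>
      have "B (P' s) (P s) + form_a N xf h \<alpha> f F (u s) (u s) + \<gamma>A * form_J 0 xf h r w (u s) (u s) = 0"
        using scheme[of s "u s"] B[OF P' P, of s s] space[of s] s by simp
      moreover have "0 \<le> form_a N xf h \<alpha> f F (u s) (u s)"
        using form_a_nonneg[OF mesh flux P] s by simp
      moreover have "0 \<le> \<gamma>A * form_J 0 xf h r w (u s) (u s)"
        using gammas form_J_nonneg[OF \<open>0 < h\<close> weights] by simp
      ultimately have "2 * B (P' s) (P s) \<le> 0" by linarith
      moreover have "((\<lambda>s. B (P s) (P s)) has_real_derivative 2 * B (P' s) (P s)) (at s)"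
        using B_deriv[of s] s by (simp add: at_within_interior[of s "{0..}"] interior_real_atLeast)
      ultimately show "\<exists>y. ((\<lambda>s. B (P s) (P s)) has_real_derivative y) (at s) \<and> y \<le> 0" by blast
    next
      have "continuous_on {0..} (\<lambda>s. B (P s) (P s))"
        by (rule DERIV_continuous_on) (use B_deriv in auto)
      then show "continuous_on {0..t} (\<lambda>s. B (P s) (P s))" by (rule continuous_on_subset) auto
    qed
    then show "(L2_norm ?\<Omega> (u t))\<^sup>2 + \<gamma>M * form_J 1 xf h r w (u t) (u t)
      \<le> (L2_norm ?\<Omega> (u 0))\<^sup>2 + \<gamma>M * form_J 1 xf h r w (u 0) (u 0)"
      unfolding norm using B[OF P P, of t t] B[OF P P, of 0 0] t by simp
  qed
qed

end
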